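(* Let $T_1,T_2$ be trees on $n$ vertices such that $T_2$ covers $T_1$ in $\mathsf{GTS}_n$, and let the covering be witnessed by a generalized tree shift of $T_1$ along a path $P_k$ from vertex $1$ to vertex $k$ (internal vertices of degree $2$ in $T_1$, neither $1$ nor $k$ a leaf of $T_1$), producing $T_2$. Let $H_1$ and $H_2$ be the connected components of $T_1-E(P_k)$ containing $1$ and $k$ respectively. Then for every $q\in\mathbb{R}\setminus\{0\}$, as rational functions of $x$, $$f^{\mathcal{L}_{T_1}^{q}}(q,x)-f^{\mathcal{L}_{T_2}^{q}}(q,x)=-\frac{1}{q^2x}\,\mathcal{F}_{P_k}^{1}(q,x)\,\mathcal{F}_{H_1}^{1}(q,x)\,\mathcal{F}_{H_2}^{k}(q,x),$$ where in $\mathcal{F}_{P_k}^{1}$ the distinguished vertex is the endpoint $1$ of the path, in $\mathcal{F}_{H_1}^1$ it is vertex $1$, and in $\mathcal{F}_{H_2}^k$ it is vertex $k$.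
   Context: For a tree $T$ with degree matrix $D$ and adjacency matrix $A$, $\mathcal{L}_T^q=I+q^2(D-I)-qA$. $f^{\mathcal{L}_T^q}(q,x)=\det(xI-\mathcal{L}_T^q)$; for a vertex $v$, $\mathcal{L}_T^q|v$ is the principal submatrix obtained by deleting row and column $v$, and $f^{\mathcal{L}_T^q|v}(q,x)=\det(xI-\mathcal{L}_T^q|v)$. The auxiliary polynomial is $\mathcal{F}_T^v(q,x)=f^{\mathcal{L}_T^q}(q,x)-(x+q^2-1)f^{\mathcal{L}_T^q|v}(q,x)$. Generalized tree shift: for a tree $T$ and distinct vertices $u,w$ such that each internal vertex of the $u$–$w$ path $P$ has degree 2, with $w'$ the neighbour of $w$ on $P$, replace each edge $\{w,z\}$, $z\ne w'$, by $\{u,z\}$. $\mathsf{GTS}_n$: partial order on isomorphism classes of $n$-vertex trees, $T_1\le T_2$ iff $T_2$ arises from $T_1$ by finitely many generalized tree shifts; $T_2$ covers $T_1$ if $T_1\le T_2$, $T_1\ne T_2$, and no tree lies strictly between them. *)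

theory Defs
  imports
    "Graph_Theory.Graph_Theory"
    "Jordan_Normal_Form.Char_Poly"
    "HOL-Computational_Algebra.Polynomial_Factorial"
begin

section \<open>Trees\<close>

text \<open>
  Finite simple graphs are the symmetric loop-free finite digraphs \<open>pair_graph\<close>: an edge is a pair
  of opposite arcs, so \<open>out_degree\<close> is the degree. The library predicate \<open>tree\<close> is meant for
  oriented digraphs: it counts the closed walk \<open>u, v, u\<close> as a cycle, so no graph with an edge would
  be a tree. Undirected cycles are the library cycles with at least three arcs.
\<close>

definition is_tree :: "'a pair_pre_digraph \<Rightarrow> bool" where
  "is_tree G \<longleftrightarrow> pair_graph G \<and> connected (with_proj G) \<and>
     \<not> (\<exists>c. pre_digraph.cycle (with_proj G) c \<and> 3 \<le> length c)"

definition trees_on :: "nat \<Rightarrow> 'a pair_pre_digraph set" where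
  "trees_on n = {G. is_tree G \<and> card (pverts G) = n}"

abbreviation graph_iso :: "'a pair_pre_digraph \<Rightarrow> 'b pair_pre_digraph \<Rightarrow> bool" where
  "graph_iso G H \<equiv> digraph_iso (with_proj G) (with_proj H)"

abbreviation degree_of :: "'a pair_pre_digraph \<Rightarrow> 'a \<Rightarrow> nat" where
  "degree_of G v \<equiv> out_degree (with_proj G) v"

definition is_leaf :: "'a pair_pre_digraph \<Rightarrow> 'a \<Rightarrow> bool" where
  "is_leaf G v \<longleftrightarrow> v \<in> pverts G \<and> degree_of G v = 1"


section \<open>The \<open>q\<close>-Laplacian and its characteristic polynomials\<close>

text \<open>Rows and columns are indexed by the vertices in increasing order.\<close>

definition vertex_list :: "'a::linorder pair_pre_digraph \<Rightarrow> 'a list" where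
  "vertex_list G = sorted_list_of_set (pverts G)"

definition vertex_index :: "'a::linorder pair_pre_digraph \<Rightarrow> 'a \<Rightarrow> nat" where
  "vertex_index G v = (THE i. i < card (pverts G) \<and> vertex_list G ! i = v)"

definition degree_matrix :: "'a::linorder pair_pre_digraph \<Rightarrow> real mat" where
  "degree_matrix G = mat (card (pverts G)) (card (pverts G))
     (\<lambda>(i, j). if i = j then real (degree_of G (vertex_list G ! i)) else 0)"

definition adjacency_matrix :: "'a::linorder pair_pre_digraph \<Rightarrow> real mat" where
  "adjacency_matrix G = mat (card (pverts G)) (card (pverts G))
     (\<lambda>(i, j). if (vertex_list G ! i, vertex_list G ! j) \<in> parcs G then 1 else 0)"

definition q_laplacian :: "real \<Rightarrow> 'a::linorder pair_pre_digraph \<Rightarrow> real mat" where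
  "q_laplacian q G =
     1\<^sub>m (card (pverts G))
     + q\<^sup>2 \<cdot>\<^sub>m (degree_matrix G - 1\<^sub>m (card (pverts G)))
     - q \<cdot>\<^sub>m adjacency_matrix G"

definition f_lap :: "real \<Rightarrow> 'a::linorder pair_pre_digraph \<Rightarrow> real poly" where
  "f_lap q G = char_poly (q_laplacian q G)"

definition f_lap_del :: "real \<Rightarrow> 'a::linorder pair_pre_digraph \<Rightarrow> 'a \<Rightarrow> real poly" where
  "f_lap_del q G v =
     char_poly (mat_delete (q_laplacian q G) (vertex_index G v) (vertex_index G v))"

definition F_aux :: "real \<Rightarrow> 'a::linorder pair_pre_digraph \<Rightarrow> 'a \<Rightarrow> real poly" where
  "F_aux q G v = f_lap q G - [: q\<^sup>2 - 1, 1 :] * f_lap_del q G v"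


section \<open>Generalized tree shift\<close>

text \<open>
  A path is given by its list of vertices \<open>P\<close>; the vertices called \<open>u\<close> and \<open>w\<close> in the shift are
  \<open>hd P\<close> and \<open>last P\<close>. A path with two vertices has no internal vertex.
\<close>

definition gts_path :: "'a pair_pre_digraph \<Rightarrow> 'a list \<Rightarrow> bool" where
  "gts_path T P \<longleftrightarrow> 2 \<le> length P \<and> vpath P (with_proj T) \<and>
     (\<forall>v \<in> set P - {hd P, last P}. degree_of T v = 2)"

definition gts :: "'a pair_pre_digraph \<Rightarrow> 'a list \<Rightarrow> 'a pair_pre_digraph" where
  "gts T P = (let u = hd P; w = last P; w' = last (butlast P);
                  Z = {z. (w, z) \<in> parcs T \<and> z \<noteq> w'}
     in \<lparr> pverts = pverts T,
          parcs = (parcs T - ({w} \<times> Z \<union> Z \<times> {w})) \<union> ({u} \<times> Z \<union> Z \<times> {u}) \<rparr>)"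

definition gts_step :: "'a pair_pre_digraph \<Rightarrow> 'a pair_pre_digraph \<Rightarrow> bool" where
  "gts_step T T' \<longleftrightarrow> (\<exists>P. gts_path T P \<and> T' = gts T P)"

text \<open>
  The poset consists of isomorphism classes of trees. It is expressed on representatives, with
  isomorphism in place of equality. As \<open>gts\<close> keeps the vertex set and commutes with isomorphisms,
  it suffices to pass to an isomorphic copy once, after the last shift.
\<close>

definition gts_le :: "'a pair_pre_digraph \<Rightarrow> 'a pair_pre_digraph \<Rightarrow> bool" where
  "gts_le T1 T2 \<longleftrightarrow> (\<exists>S. gts_step\<^sup>*\<^sup>* T1 S \<and> graph_iso S T2)"

definition gts_less :: "'a pair_pre_digraph \<Rightarrow> 'a pair_pre_digraph \<Rightarrow> bool" where
  "gts_less T1 T2 \<longleftrightarrow> gts_le T1 T2 \<and> \<not> graph_iso T1 T2"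

text \<open>\<open>gts_covers n T1 T2\<close>: \<open>T2\<close> covers \<open>T1\<close>.\<close>

definition gts_covers :: "nat \<Rightarrow> 'a pair_pre_digraph \<Rightarrow> 'a pair_pre_digraph \<Rightarrow> bool" where
  "gts_covers n T1 T2 \<longleftrightarrow> T1 \<in> trees_on n \<and> T2 \<in> trees_on n \<and> gts_less T1 T2 \<and>
     \<not> (\<exists>T \<in> trees_on n. gts_less T1 T \<and> gts_less T T2)"

definition path_graph :: "'a list \<Rightarrow> 'a pair_pre_digraph" where
  "path_graph P = \<lparr> pverts = set P, parcs = set (vwalk_arcs P) \<union> (set (vwalk_arcs P))\<inverse> \<rparr>"

definition delete_edges :: "'a pair_pre_digraph \<Rightarrow> 'a rel \<Rightarrow> 'a pair_pre_digraph" where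
  "delete_edges G E = \<lparr> pverts = pverts G, parcs = parcs G - E \<rparr>"

text \<open>For symmetric digraphs the strongly connected components are the connected components.\<close>

definition is_component :: "'a pair_pre_digraph \<Rightarrow> 'a pair_pre_digraph \<Rightarrow> bool" where
  "is_component H G \<longleftrightarrow> with_proj H \<in> pre_digraph.sccs (with_proj G)"

end

theory Submission
  imports Defs
begin

text \<open>
  The matrix \<open>x I - L\<close> is treated as a determinant indexed by the vertices themselves. At a cut
  vertex the diagonal entry is additive up to the constant \<open>c = x + q\<^sup>2 - 1\<close>, so the determinant of
  a tree obtained by gluing \<open>A\<close> and \<open>B\<close> at \<open>v\<close> is \<open>F A v * f (B | v) + f (A | v) * f B\<close>, where \<open>F\<close>
  is the auxiliary polynomial \<open>f A - c * f (A | v)\<close>. In both trees \<open>H2\<close> is glued to \<open>H1 \<union> P\<close>, at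
  \<open>w\<close> and at \<open>u\<close> respectively. By the symmetry of the path everything cancels in the difference
  except \<open>F H1 u * F H2 w * f (P | u, w)\<close>. Finally \<open>F P u = - q\<^sup>2 x f (P | u, w)\<close> by the three-term
  recurrence for tridiagonal determinants.
\<close>

section \<open>Determinants over finite index sets\<close>

text \<open>Leibniz's formula over an arbitrary finite index set. Deleting a vertex becomes a set
  difference, so trees can be cut and glued without renumbering rows and columns.\<close>

definition sdet :: "'a set \<Rightarrow> ('a \<Rightarrow> 'a \<Rightarrow> 'r::comm_ring_1) \<Rightarrow> 'r" where
  "sdet S M = (\<Sum>p | p permutes S. of_int (sign p) * (\<Prod>i\<in>S. M i (p i)))"

lemma sdet_cong:
  assumes "\<And>i j. i \<in> S \<Longrightarrow> j \<in> S \<Longrightarrow> M i j = N i j"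
  shows "sdet S M = sdet S N"
  unfolding sdet_def
  by (intro sum.cong arg_cong2[where f = "(*)"] prod.cong refl assms)
     (auto simp: permutes_in_image)

lemma sdet_empty [simp]: "sdet {} M = 1"
  by (simp add: sdet_def)

text \<open>Conjugation by \<open>f\<close> is a bijection between the permutations of
  \<open>A\<close> and those of \<open>B\<close>; it keeps the sign and carries the Leibniz products
  to one another.\<close>

lemma sdet_reindex:
  assumes "finite A" "bij_betw f A B"
  shows "sdet B M = sdet A (\<lambda>i j. M (f i) (f j))"
proof -
  have "bij_betw (map_permutation A f) {p. p permutes A} {p. p permutes B}"
    by (rule bij_betw_cong[THEN iffD1, OF _ bij_betw_permutations[OF assms(2)]])
       (use assms(2) in \<open>auto simp: map_permutation_def restrict_id_def bij_betw_def fun_eq_iff\<close>)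
  then have "sdet B M = (\<Sum>p | p permutes A. of_int (sign (map_permutation A f p)) *
      (\<Prod>i\<in>B. M i (map_permutation A f p i)))"
    unfolding sdet_def by (subst sum.reindex_bij_betw[symmetric]) auto
  also have "\<dots> = sdet A (\<lambda>i j. M (f i) (f j))"
    unfolding sdet_def
  proof (intro sum.cong refl arg_cong2[where f = "(*)"])
    fix p assume "p \<in> {p. p permutes A}"
    then have p: "p permutes A" by simp
    have inj: "inj_on f A" using assms(2) by (auto simp: bij_betw_def)
    show "of_int (sign (map_permutation A f p)) = (of_int (sign p) :: 'c)"
      using sign_map_permutation[OF inj p assms(1)] by simp
    have "(\<Prod>i\<in>B. M i (map_permutation A f p i)) =
        (\<Prod>i\<in>A. M (f i) (map_permutation A f p (f i)))"
      using assms(2) by (subst prod.reindex_bij_betw[symmetric]) auto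
    also have "\<dots> = (\<Prod>i\<in>A. M (f i) (f (p i)))"
      using inj by (intro prod.cong refl) (simp add: map_permutation_apply)
    finally show "(\<Prod>i\<in>B. M i (map_permutation A f p i)) = (\<Prod>i\<in>A. M (f i) (f (p i)))" .
  qed
  finally show ?thesis .
qed

lemma sdet_list:
  assumes "distinct xs" "length xs = n"
  shows "sdet (set xs) M = det (mat n n (\<lambda>(i, j). M (xs ! i) (xs ! j)))"
proof -
  have "sdet (set xs) M = sdet {0..<n} (\<lambda>i j. M (xs ! i) (xs ! j))"
    using assms by (intro sdet_reindex) (auto simp: bij_betw_def inj_on_nth set_conv_nth)
  also have "\<dots> = det (mat n n (\<lambda>(i, j). M (xs ! i) (xs ! j)))"
    unfolding sdet_def
    by (subst det_def'[where n = n])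
       (auto intro!: sum.cong arg_cong2[where f = "(*)"] prod.cong simp: permutes_in_image)
  finally show ?thesis .
qed

text \<open>With \<open>A\<close> listed before \<open>B\<close> the matrix is block lower
  triangular. Zeros are demanded on one side only, because in \<open>sdet_glue\<close> the row of
  the cut vertex is truncated while its column stays intact.\<close>

lemma sdet_union:
  fixes M :: "'a \<Rightarrow> 'a \<Rightarrow> 'r::idom"
  assumes "finite A" "finite B" "A \<inter> B = {}"
    and zero: "\<And>i j. i \<in> A \<Longrightarrow> j \<in> B \<Longrightarrow> M i j = 0"
  shows "sdet (A \<union> B) M = sdet A M * sdet B M"
proof -
  obtain as where as: "set as = A" "distinct as" using assms(1) finite_distinct_list by blast
  obtain bs where bs: "set bs = B" "distinct bs" using assms(2) finite_distinct_list by blast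
  let ?n = "length as" and ?m = "length bs"
  let ?mat = "\<lambda>xs ys. mat (length xs) (length ys) (\<lambda>(i, j). M (xs ! i) (ys ! j))"
  have "sdet (A \<union> B) M = det (mat (?n + ?m) (?n + ?m)
      (\<lambda>(i, j). M ((as @ bs) ! i) ((as @ bs) ! j)))"
    using as bs assms(3) sdet_list[of "as @ bs" "?n + ?m" M] by simp
  also have "mat (?n + ?m) (?n + ?m) (\<lambda>(i, j). M ((as @ bs) ! i) ((as @ bs) ! j)) =
      four_block_mat (?mat as as) (0\<^sub>m ?n ?m) (?mat bs as) (?mat bs bs)"
    using as bs zero by (intro eq_matI) (auto simp: four_block_mat_def Let_def nth_append)
  also have "det \<dots> = det (?mat as as) * det (?mat bs bs)"
    by (rule det_four_block_mat_upper_right_zero) auto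
  finally show ?thesis
    using sdet_list[OF as(2) refl, of M] sdet_list[OF bs(2) refl, of M] as bs by simp
qed

text \<open>Each Leibniz product has exactly one factor from row \<open>v\<close>, and its other
  factors agree in the three matrices.\<close>

lemma sdet_row_add:
  assumes "finite S" "v \<in> S"
    and row: "\<And>j. j \<in> S \<Longrightarrow> M v j = M1 v j + M2 v j"
    and other: "\<And>i j. i \<in> S \<Longrightarrow> i \<noteq> v \<Longrightarrow> j \<in> S \<Longrightarrow> M i j = M1 i j \<and> M i j = M2 i j"
  shows "sdet S M = sdet S M1 + sdet S M2"
  unfolding sdet_def sum.distrib[symmetric]
proof (intro sum.cong refl)
  fix p assume "p \<in> {p. p permutes S}"
  then have p: "i \<in> S \<Longrightarrow> p i \<in> S" for i by (simp add: permutes_in_image)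
  have *: "(\<Prod>i\<in>S. N i (p i)) = N v (p v) * (\<Prod>i\<in>S - {v}. N i (p i))" for N
    using assms(1,2) by (rule prod.remove)
  have "(\<Prod>i\<in>S - {v}. M i (p i)) = (\<Prod>i\<in>S - {v}. M1 i (p i))"
    "(\<Prod>i\<in>S - {v}. M i (p i)) = (\<Prod>i\<in>S - {v}. M2 i (p i))"
    by (rule prod.cong[OF refl]; use other p in blast)+
  then show "of_int (sign p) * (\<Prod>i\<in>S. M i (p i)) =
      of_int (sign p) * (\<Prod>i\<in>S. M1 i (p i)) + of_int (sign p) * (\<Prod>i\<in>S. M2 i (p i))"
    using row[OF p[OF assms(2)]] unfolding * by (simp add: algebra_simps)
qed

lemma sdet_singleton [simp]: "sdet {v} M = M v v"
  by (simp add: sdet_def)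

lemma sdet_diag_shift:
  fixes M N :: "'a \<Rightarrow> 'a \<Rightarrow> 'r::idom"
  assumes "finite S" "v \<in> S" "M v v = N v v + c"
    and "\<And>i j. i \<in> S \<Longrightarrow> j \<in> S \<Longrightarrow> \<not> (i = v \<and> j = v) \<Longrightarrow> M i j = N i j"
  shows "sdet S M = sdet S N + c * sdet (S - {v}) N"
proof -
  \<comment> \<open>\<open>?C\<close> is \<open>N\<close> with row \<open>v\<close> replaced by
    \<open>c\<close> times the unit row. It is block triangular for \<open>{v}\<close> and
    \<open>S - {v}\<close>, so it contributes \<open>c\<close> times the minor.\<close>
  let ?C = "\<lambda>i j. if i = v then if j = v then c else 0 else N i j"
  have "sdet S M = sdet S N + sdet S ?C"
    by (rule sdet_row_add[of S v]) (use assms in auto)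
  also have "sdet S ?C = sdet ({v} \<union> (S - {v})) ?C"
    using assms(2) by (intro arg_cong2[where f = sdet]) auto
  also have "\<dots> = c * sdet (S - {v}) ?C"
    using assms(1) by (subst sdet_union) auto
  also have "sdet (S - {v}) ?C = sdet (S - {v}) N"
    by (rule sdet_cong) auto
  finally show ?thesis .
qed

text \<open>The row of the cut vertex is split into its part in \<open>A\<close> and its part in \<open>B\<close>; each of the two
  resulting matrices is block triangular.\<close>

lemma sdet_glue:
  fixes M M1 M2 :: "'a \<Rightarrow> 'a \<Rightarrow> 'r::idom"
  assumes fin: "finite A" "finite B" and AB: "A \<inter> B = {v}"
    and cross: "\<And>i j. i \<in> A - {v} \<Longrightarrow> j \<in> B - {v} \<Longrightarrow> M i j = 0 \<and> M j i = 0"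
    and M1: "\<And>i j. i \<in> A \<Longrightarrow> j \<in> A \<Longrightarrow> \<not> (i = v \<and> j = v) \<Longrightarrow> M i j = M1 i j"
    and M2: "\<And>i j. i \<in> B \<Longrightarrow> j \<in> B \<Longrightarrow> \<not> (i = v \<and> j = v) \<Longrightarrow> M i j = M2 i j"
    and diag: "M v v = M1 v v + M2 v v - c"
  shows "sdet (A \<union> B) M =
    (sdet A M1 - c * sdet (A - {v}) M1) * sdet (B - {v}) M2 + sdet (A - {v}) M1 * sdet B M2"
proof -
  have v: "v \<in> A" "v \<in> B" using AB by auto
  \<comment> \<open>The entry \<open>M v v\<close> is divided into \<open>M1 v v - c\<close> for
    \<open>X\<close> and \<open>M2 v v\<close> for \<open>Y\<close>. Charging all of
    \<open>c\<close> to \<open>X\<close> produces the factor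
    \<open>sdet A M1 - c * sdet (A - {v}) M1\<close>.\<close>
  define X where "X = (\<lambda>i j. if i = v then if j = v then M1 v v - c else if j \<in> A then M v j else 0
    else M i j)"
  define Y where "Y = (\<lambda>i j. if i = v then if j = v then M2 v v else if j \<in> B then M v j else 0
    else M i j)"
  have "sdet (A \<union> B) M = sdet (A \<union> B) X + sdet (A \<union> B) Y"
    by (rule sdet_row_add[of _ v]) (use fin v AB diag in \<open>auto simp: X_def Y_def algebra_simps\<close>)
  \<comment> \<open>The vertex \<open>v\<close> is counted with \<open>A\<close> for
    \<open>X\<close>, and with \<open>B\<close> for \<open>Y\<close> below: its truncated row
    vanishes outside that part.\<close>
  also have "sdet (A \<union> B) X = sdet (A \<union> (B - {v})) X"
    using v by (intro arg_cong2[where f = sdet]) auto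
  also have "\<dots> = sdet A X * sdet (B - {v}) X"
    by (rule sdet_union) (use fin v AB cross in \<open>auto simp: X_def\<close>)
  also have "sdet (B - {v}) X = sdet (B - {v}) M2"
    by (rule sdet_cong) (use M2 in \<open>auto simp: X_def\<close>)
  also have "sdet A X = sdet A M1 + (- c) * sdet (A - {v}) M1"
    by (rule sdet_diag_shift) (use fin v M1 in \<open>auto simp: X_def\<close>)
  also have "sdet (A \<union> B) Y = sdet (B \<union> (A - {v})) Y"
    using v by (intro arg_cong2[where f = sdet]) auto
  also have "\<dots> = sdet B Y * sdet (A - {v}) Y"
    by (rule sdet_union) (use fin v AB cross in \<open>auto simp: Y_def\<close>)
  also have "sdet (A - {v}) Y = sdet (A - {v}) M1"
    by (rule sdet_cong) (use M1 in \<open>auto simp: Y_def\<close>)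
  also have "sdet B Y = sdet B M2"
    by (rule sdet_cong) (use M2 in \<open>auto simp: Y_def\<close>)
  finally show ?thesis by (simp add: algebra_simps)
qed

section \<open>Tridiagonal determinants and continuants\<close>

lemma sdet_pair:
  assumes "x \<noteq> y"
  shows "sdet {x, y} M = M x x * M y y - M x y * M y x"
proof -
  have "{p. p permutes {x, y}} = {id, transpose x y}"
    by (auto simp: permutes_doubleton_iff)
  moreover have "id \<noteq> transpose x y"
    using assms by (metis id_apply transpose_apply_first)
  ultimately show ?thesis
    using assms by (simp add: sdet_def sign_swap_id)
qed

text \<open>The two-vertex block \<open>{x, y}\<close> is glued onto \<open>S\<close> at
  \<open>y\<close>.\<close>

lemma sdet_pendant:
  fixes M :: "'a \<Rightarrow> 'a \<Rightarrow> 'r::idom"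
  assumes "finite S" "y \<in> S" "x \<notin> S"
    and "\<And>z. z \<in> S - {y} \<Longrightarrow> M x z = 0 \<and> M z x = 0"
  shows "sdet (insert x S) M = M x x * sdet S M - M x y * M y x * sdet (S - {y}) M"
proof -
  have ne: "x \<noteq> y" using assms by auto
  \<comment> \<open>The block gets diagonal entry 0 at \<open>y\<close>, and the gluing constant is
    0, so \<open>M y y\<close> is left wholly to \<open>S\<close>.\<close>
  have "sdet ({x, y} \<union> S) M =
    (sdet {x, y} (M(y := (M y)(y := 0))) - 0 * sdet ({x, y} - {y}) (M(y := (M y)(y := 0)))) *
      sdet (S - {y}) M + sdet ({x, y} - {y}) (M(y := (M y)(y := 0))) * sdet S M"
    by (rule sdet_glue) (use assms ne in auto)
  moreover have "{x, y} - {y} = {x}" "{x, y} \<union> S = insert x S" using assms ne by auto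
  ultimately show ?thesis using ne by (simp add: sdet_pair algebra_simps)
qed

text \<open>The determinant of a tridiagonal matrix with the list as its diagonal, where
  \<open>b\<close> is the product of two opposite off-diagonal entries.\<close>

fun continuant :: "'r::comm_ring_1 \<Rightarrow> 'r list \<Rightarrow> 'r" where
  "continuant b [] = 1"
| "continuant b [a] = a"
| "continuant b (a # a' # as) = a * continuant b (a' # as) - b * continuant b as"

definition tridiagonal :: "('a \<Rightarrow> 'a \<Rightarrow> 'r::comm_ring_1) \<Rightarrow> 'r \<Rightarrow> 'a list \<Rightarrow> bool" where
  "tridiagonal M c xs \<longleftrightarrow> (\<forall>i < length xs. \<forall>j < length xs. i \<noteq> j \<longrightarrow>
     M (xs ! i) (xs ! j) = (if i = Suc j \<or> j = Suc i then c else 0))"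

lemma tridiagonal_appendD1: "tridiagonal M c (xs @ ys) \<Longrightarrow> tridiagonal M c xs"
  unfolding tridiagonal_def
  by (metis (no_types, lifting) length_append nth_append trans_less_add1)

lemma tridiagonal_ConsD:
  assumes "tridiagonal M c (x # xs)"
  shows "tridiagonal M c xs"
  unfolding tridiagonal_def
proof (intro allI impI)
  fix i j assume "i < length xs" "j < length xs" "i \<noteq> j"
  then show "M (xs ! i) (xs ! j) = (if i = Suc j \<or> j = Suc i then c else 0)"
    using assms[unfolded tridiagonal_def, rule_format, of "Suc i" "Suc j"] by simp
qed

text \<open>The first index is pendant on the second, so \<open>sdet_pendant\<close> gives exactly
  the recurrence of \<open>continuant\<close>.\<close>

lemma sdet_tridiagonal:
  fixes M :: "'a \<Rightarrow> 'a \<Rightarrow> 'r::idom"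
  assumes "distinct xs" "tridiagonal M c xs"
  shows "sdet (set xs) M = continuant (c\<^sup>2) (map (\<lambda>x. M x x) xs)"
  using assms
proof (induction xs rule: induct_list012)
  case (3 x y zs)
  have xy: "M x y = c" "M y x = c"
    using "3.prems"(2)[unfolded tridiagonal_def, rule_format, of 0 1]
      "3.prems"(2)[unfolded tridiagonal_def, rule_format, of 1 0] by auto
  have far: "M x z = 0 \<and> M z x = 0" if "z \<in> set (y # zs) - {y}" for z
  proof -
    have "z \<in> set zs" using that by auto
    then obtain k where k: "k < length zs" "zs ! k = z" by (auto simp: in_set_conv_nth)
    show ?thesis
      using "3.prems"(2)[unfolded tridiagonal_def, rule_format, of 0 "Suc (Suc k)"]
        "3.prems"(2)[unfolded tridiagonal_def, rule_format, of "Suc (Suc k)" 0] k by auto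
  qed
  have "sdet (insert x (set (y # zs))) M =
      M x x * sdet (set (y # zs)) M - M x y * M y x * sdet (set (y # zs) - {y}) M"
    by (rule sdet_pendant) (use "3.prems" far in auto)
  moreover have "set (y # zs) - {y} = set zs" using "3.prems" by auto
  ultimately show ?case
    using "3.IH" "3.prems" tridiagonal_ConsD[OF "3.prems"(2)]
      tridiagonal_ConsD[OF tridiagonal_ConsD[OF "3.prems"(2)]] xy
    by (simp add: power2_eq_square)
qed auto

text \<open>The determinant is affine in its last diagonal entry, with the preceding minor as
  coefficient. Since the recursion consumes the list from the front, this takes an
  induction.\<close>

lemma continuant_replicate_snoc:
  "continuant b (replicate m d @ [d + b]) =
    continuant b (replicate (Suc m) d) + b * continuant b (replicate m d)"
proof (induction m rule: induct_nat_012)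
  case (ge2 m)
  then show ?case
    by (simp only: replicate_Suc append_Cons continuant.simps) (simp add: algebra_simps)
qed (simp_all add: algebra_simps)

lemma continuant_Cons_replicate:
  "continuant b ((d + b) # replicate m d) =
    continuant b (replicate (Suc m) d) + b * continuant b (replicate m d)"
  by (cases m) (simp_all add: algebra_simps)

text \<open>For d = x - 1 - q^2 and b = q^2 the factor \<open>d + 2 * b\<close> is the gluing
  constant x + q^2 - 1 and \<open>d + 1 + b\<close> is x. The left side is then the auxiliary
  polynomial of a path with \<open>m\<close> inner vertices.\<close>

lemma continuant_path:
  "continuant b ((d + b) # replicate m d @ [d + b])
     - (d + 2 * b) * continuant b (replicate m d @ [d + b]) =
   - b * (d + 1 + b) * continuant b (replicate m d)"
proof (cases m)
  case (Suc k)
  \<comment> \<open>This is the previous lemma with the longer continuant expanded once more; the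
    expansion makes the terms in \<open>replicate k d\<close> cancel in the final
    computation.\<close>
  have "continuant b (d # replicate k d @ [d + b]) =
      d * continuant b (d # replicate k d) - b * continuant b (replicate k d)
        + b * continuant b (d # replicate k d)"
    using continuant_replicate_snoc[of b m d] Suc by simp
  then show ?thesis
    by (simp only: Suc replicate_Suc append_Cons continuant.simps continuant_replicate_snoc)
       (simp add: algebra_simps)
qed (simp add: algebra_simps)

section \<open>Determinants of weighted graphs and paths\<close>

text \<open>The entries of xI - L, read off from the arcs alone. At degree 0 the diagonal entry is x
  + q^2 - 1; as degrees add under gluing, this constant is counted twice and must be subtracted
  once.\<close>

definition lap :: "real \<Rightarrow> 'a rel \<Rightarrow> 'a \<Rightarrow> 'a \<Rightarrow> real poly" where
  "lap q E i j = (if i = j then [: q\<^sup>2 - 1 - q\<^sup>2 * real (card (E `` {i})), 1 :]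
     else if (i, j) \<in> E then [: q :] else 0)"

lemma degree_of_conv_card: "degree_of G v = card (parcs G `` {v})"
  unfolding out_degree_def
  by (rule bij_betw_same_card[where f = snd])
     (auto simp: bij_betw_def inj_on_def out_arcs_def image_iff)

lemma vertex_list_facts:
  assumes "finite (pverts G)"
  shows "set (vertex_list G) = pverts G" "distinct (vertex_list G)"
    "length (vertex_list G) = card (pverts G)"
  using assms by (auto simp: vertex_list_def)

lemma q_laplacian_dim [simp]:
  "dim_row (q_laplacian q G) = card (pverts G)" "dim_col (q_laplacian q G) = card (pverts G)"
  by (auto simp: q_laplacian_def adjacency_matrix_def)

lemma q_laplacian_entry:
  assumes "finite (pverts G)" "\<And>v. (v, v) \<notin> parcs G"
    and "i < card (pverts G)" "j < card (pverts G)"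
  shows "(if i = j then [:0, 1:] else 0) + [: - (q_laplacian q G $$ (i, j)) :] =
    lap q (parcs G) (vertex_list G ! i) (vertex_list G ! j)"
  using assms vertex_list_facts[OF assms(1)]
  by (auto simp: q_laplacian_def degree_matrix_def adjacency_matrix_def lap_def
      degree_of_conv_card nth_eq_iff_index_eq algebra_simps)

lemma f_lap_eq_sdet:
  assumes "finite (pverts G)" "\<And>v. (v, v) \<notin> parcs G"
  shows "f_lap q G = sdet (pverts G) (lap q (parcs G))"
proof -
  note vl = vertex_list_facts[OF assms(1)]
  have "char_poly_matrix (q_laplacian q G) = mat (card (pverts G)) (card (pverts G))
      (\<lambda>(i, j). lap q (parcs G) (vertex_list G ! i) (vertex_list G ! j))"
    by (intro eq_matI)
       (auto simp: char_poly_matrix_def q_laplacian_entry[OF assms, symmetric])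
  then show ?thesis
    unfolding f_lap_def char_poly_def
    using sdet_list[OF vl(2,3)] vl(1) by metis
qed

lemma f_lap_del_eq_sdet:
  assumes "finite (pverts G)" "\<And>v. (v, v) \<notin> parcs G" "v \<in> pverts G"
  shows "f_lap_del q G v = sdet (pverts G - {v}) (lap q (parcs G))"
proof -
  note vl = vertex_list_facts[OF assms(1)]
  define xs where "xs = vertex_list G"
  define n where "n = card (pverts G)"
  define k where "k = vertex_index G v"
  obtain k' where k': "k' < n" "xs ! k' = v"
    using vl assms(3) by (metis in_set_conv_nth n_def xs_def)
  have "k = k'"
    unfolding k_def vertex_index_def using k' vl
    by (intro the_equality) (auto simp: xs_def n_def nth_eq_iff_index_eq)
  with k' have k: "k < n" "xs ! k = v" by auto
  \<comment> \<open>The vertex list without position \<open>k\<close>. Position \<open>i\<close> of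
    \<open>ys\<close> comes from position \<open>i\<close> or \<open>Suc i\<close> of
    \<open>xs\<close>, the same skip as in \<open>mat_delete\<close>.\<close>
  define ys where "ys = take k xs @ drop (Suc k) xs"
  have xs: "xs = take k xs @ v # drop (Suc k) xs"
    using k vl by (metis id_take_nth_drop n_def xs_def)
  have "distinct (take k xs @ v # drop (Suc k) xs)" "set (take k xs @ v # drop (Suc k) xs) = pverts G"
    using xs vl xs_def by auto
  then have ys: "distinct ys" "set ys = pverts G - {v}"
    by (auto simp: ys_def)
  have len: "length ys = n - 1"
    using k vl by (auto simp: ys_def xs_def n_def)
  have nth: "ys ! i = xs ! (if i < k then i else Suc i)" if "i < n - 1" for i
    using that k vl by (auto simp: ys_def nth_append xs_def n_def)
  have "char_poly_matrix (mat_delete (q_laplacian q G) k k) = mat (n - 1) (n - 1)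
      (\<lambda>(i, j). lap q (parcs G) (ys ! i) (ys ! j))"
  proof (intro eq_matI)
    fix i j
    assume "i < dim_row (mat (n - 1) (n - 1) (\<lambda>(i, j). lap q (parcs G) (ys ! i) (ys ! j)))"
      "j < dim_col (mat (n - 1) (n - 1) (\<lambda>(i, j). lap q (parcs G) (ys ! i) (ys ! j)))"
    then have ij: "i < n - 1" "j < n - 1" by auto
    let ?s = "\<lambda>i. if i < k then i else Suc i"
    have "lap q (parcs G) (ys ! i) (ys ! j) =
        (if ?s i = ?s j then [:0, 1:] else 0) + [: - (q_laplacian q G $$ (?s i, ?s j)) :]"
      unfolding nth[OF ij(1)] nth[OF ij(2)] xs_def
      by (rule q_laplacian_entry[symmetric]) (use assms ij in \<open>auto simp: n_def\<close>)
    also have "(?s i = ?s j) = (i = j)" by auto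
    finally show "char_poly_matrix (mat_delete (q_laplacian q G) k k) $$ (i, j) =
        mat (n - 1) (n - 1) (\<lambda>(i, j). lap q (parcs G) (ys ! i) (ys ! j)) $$ (i, j)"
      using ij by (auto simp: char_poly_matrix_def mat_delete_def n_def)
  qed (auto simp: char_poly_matrix_def n_def)
  then show ?thesis
    unfolding f_lap_del_def char_poly_def k_def[symmetric]
    using sdet_list[OF ys(1) len, of "lap q (parcs G)"] ys(2) by simp
qed

lemma F_aux_eq_sdet:
  assumes "finite (pverts G)" "\<And>v. (v, v) \<notin> parcs G" "v \<in> pverts G"
  shows "F_aux q G v = sdet (pverts G) (lap q (parcs G))
    - [: q\<^sup>2 - 1, 1 :] * sdet (pverts G - {v}) (lap q (parcs G))"
  unfolding F_aux_def using assms by (simp add: f_lap_eq_sdet f_lap_del_eq_sdet)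

section \<open>Invariance under relabelling of vertices\<close>

lemma sdet_lap_image:
  assumes "finite V" "inj_on f V" "E \<subseteq> V \<times> V" "S \<subseteq> V"
  shows "sdet (f ` S) (lap q (map_prod f f ` E)) = sdet S (lap q E)"
proof -
  have inj: "inj_on f S" using assms(2,4) by (rule inj_on_subset)
  have "sdet (f ` S) (lap q (map_prod f f ` E)) =
      sdet S (\<lambda>i j. lap q (map_prod f f ` E) (f i) (f j))"
    using assms inj finite_subset by (intro sdet_reindex) (auto simp: bij_betw_def)
  also have "\<dots> = sdet S (lap q E)"
  proof (rule sdet_cong)
    fix i j assume "i \<in> S" "j \<in> S"
    then have ij: "i \<in> V" "j \<in> V" using assms(4) by auto
    \<comment> \<open>Neighbourhoods are taken in all of \<open>E\<close>, also outside
      \<open>S\<close>, so minors keep the original degrees; hence injectivity is assumed on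
      \<open>V\<close> and not just on \<open>S\<close>.\<close>
    have nbr: "(map_prod f f ` E) `` {f i} = f ` (E `` {i})"
      using assms(2,3) ij(1) by (force dest: inj_onD)
    have "card (f ` (E `` {i})) = card (E `` {i})"
      using assms(2,3) by (intro card_image) (auto intro: inj_on_subset)
    moreover have "(f i, f j) \<in> map_prod f f ` E \<longleftrightarrow> (i, j) \<in> E"
    proof
      assume "(f i, f j) \<in> map_prod f f ` E"
      then obtain a b where ab: "(a, b) \<in> E" "f i = f a" "f j = f b" by auto
      then have "a = i" "b = j" using assms(2,3) ij by (auto dest: inj_onD)
      with ab show "(i, j) \<in> E" by simp
    qed force
    moreover have "f i = f j \<longleftrightarrow> i = j"
      using assms(2) ij by (auto dest: inj_onD)
    ultimately show "lap q (map_prod f f ` E) (f i) (f j) = lap q E i j"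
      using nbr by (cases "i = j") (simp_all add: lap_def)
  qed
  finally show ?thesis .
qed

text \<open>Needed because the covering tree is only isomorphic to the shifted tree; the order of
  its vertices may differ.\<close>

lemma graph_iso_f_lap_eq:
  fixes G H :: "'a::linorder pair_pre_digraph"
  assumes iso: "graph_iso G H" and fin: "finite (pverts G)"
    and noloop: "\<And>v. (v, v) \<notin> parcs G"
  shows "f_lap q G = f_lap q H"
proof -
  obtain h where h: "pre_digraph.digraph_isomorphism (with_proj G) h"
    and H: "with_proj H = app_iso h (with_proj G)"
    using iso unfolding digraph_iso_def by blast
  define f where "f = iso_verts h"
  have inj: "inj_on f (pverts G)" and wf: "wf_digraph (with_proj G)"
    using h by (auto simp: pre_digraph.digraph_isomorphism_def f_def)
  have sub: "parcs G \<subseteq> pverts G \<times> pverts G"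
    using wf_digraph.wellformed[OF wf] by auto
  have V: "pverts H = f ` pverts G"
    using arg_cong[OF H, of verts] by (simp add: f_def)
  \<comment> \<open>A digraph isomorphism carries a separate arc map. Both graphs have
    \<open>fst\<close> and \<open>snd\<close> as tail and head, which forces that map to be induced
    by the vertex map.\<close>
  have "fst = iso_tail h" "snd = iso_head h"
    using arg_cong[OF H, of tail] arg_cong[OF H, of head] by simp_all
  then have "iso_arcs h e = map_prod f f e" if "e \<in> parcs G" for e
    using h that by (auto simp: pre_digraph.digraph_isomorphism_def f_def prod_eq_iff)
  then have E: "parcs H = map_prod f f ` parcs G"
    using arg_cong[OF H, of arcs] by auto
  have "(x, x) \<notin> parcs H" for x
    using noloop sub inj unfolding E by (force dest: inj_onD)
  then have "f_lap q H = sdet (f ` pverts G) (lap q (map_prod f f ` parcs G))"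
    using fin V E by (simp add: f_lap_eq_sdet)
  also have "\<dots> = f_lap q G"
    using sdet_lap_image[OF fin inj sub order_refl] fin noloop by (simp add: f_lap_eq_sdet)
  finally show ?thesis ..
qed

section \<open>Gluing and cutting graphs at a vertex\<close>

lemma sdet_lap_cong:
  assumes "\<And>v. v \<in> S \<Longrightarrow> E `` {v} = E' `` {v}"
  shows "sdet S (lap q E) = sdet S (lap q E')"
  by (rule sdet_cong) (use assms in \<open>auto simp: lap_def\<close>)

text \<open>Taking \<open>S\<close> inside \<open>B\<close> covers minors in which vertices of
  \<open>B\<close> other than \<open>v\<close> are deleted while the degrees are still those of
  \<open>F\<close>.\<close>

lemma sdet_lap_glue:
  assumes "finite A" "finite B" "A \<inter> B = {v}" "E \<subseteq> A \<times> A" "F \<subseteq> B \<times> B"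
    and noloop: "(v, v) \<notin> E" and S: "S \<subseteq> B" "v \<in> S"
  shows "sdet (A \<union> S) (lap q (E \<union> F)) =
    (sdet A (lap q E) - [: q\<^sup>2 - 1, 1 :] * sdet (A - {v}) (lap q E)) * sdet (S - {v}) (lap q F)
    + sdet (A - {v}) (lap q E) * sdet S (lap q F)"
proof (rule sdet_glue)
  have fin: "finite (E `` {v})" "finite (F `` {v})"
    using assms(1,2,4,5) by (auto intro: finite_subset[of _ A] finite_subset[of _ B])
  \<comment> \<open>A common neighbour would lie in \<open>A\<close> and in \<open>B\<close>, hence
    be \<open>v\<close> itself, and \<open>E\<close> has no loop there. So the degree of
    \<open>v\<close> is the sum of its degrees in the two parts.\<close>
  have "E `` {v} \<inter> F `` {v} = {}" using assms by auto
  then have "card ((E \<union> F) `` {v}) = card (E `` {v}) + card (F `` {v})"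
    using fin by (simp add: Un_Image card_Un_disjoint)
  then show "lap q (E \<union> F) v v = lap q E v v + lap q F v v - [: q\<^sup>2 - 1, 1 :]"
    by (simp add: lap_def algebra_simps)
next
  fix i j assume ij: "i \<in> A" "j \<in> A" "\<not> (i = v \<and> j = v)"
  have "(E \<union> F) `` {i} = E `` {i}" if "i \<noteq> v" using that ij assms by auto
  moreover have "(i, j) \<notin> F" using ij assms by auto
  ultimately show "lap q (E \<union> F) i j = lap q E i j" using ij by (auto simp: lap_def)
next
  fix i j assume ij: "i \<in> S" "j \<in> S" "\<not> (i = v \<and> j = v)"
  have "(E \<union> F) `` {i} = F `` {i}" if "i \<noteq> v" using that ij assms by auto
  moreover have "(i, j) \<notin> E" using ij assms by auto
  ultimately show "lap q (E \<union> F) i j = lap q F i j" using ij by (auto simp: lap_def)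
qed (use assms finite_subset in \<open>auto simp: lap_def\<close>)

lemma sdet_lap_cut:
  assumes "finite A" "finite B" "A \<inter> B = {v}" "E \<subseteq> A \<times> A" "F \<subseteq> B \<times> B"
  shows "sdet (A \<union> B - {v}) (lap q (E \<union> F)) =
    sdet (A - {v}) (lap q E) * sdet (B - {v}) (lap q F)"
proof -
  have "sdet (A \<union> B - {v}) (lap q (E \<union> F)) = sdet ((A - {v}) \<union> (B - {v})) (lap q (E \<union> F))"
    by (intro arg_cong2[where f = sdet]) auto
  also have "\<dots> = sdet (A - {v}) (lap q (E \<union> F)) * sdet (B - {v}) (lap q (E \<union> F))"
    by (rule sdet_union) (use assms in \<open>auto simp: lap_def\<close>)
  also have "sdet (A - {v}) (lap q (E \<union> F)) = sdet (A - {v}) (lap q E)"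
    by (rule sdet_lap_cong) (use assms in auto)
  also have "sdet (B - {v}) (lap q (E \<union> F)) = sdet (B - {v}) (lap q F)"
    by (rule sdet_lap_cong) (use assms in auto)
  finally show ?thesis .
qed

section \<open>Arcs, degrees and determinants of a path\<close>

lemma set_vwalk_arcs_conv_nth:
  "set (vwalk_arcs P) = {(P ! i, P ! Suc i) | i. Suc i < length P}"
proof (induction P rule: vwalk_arcs.induct)
  case (3 x y xs)
  have "{((x # y # xs) ! i, (x # y # xs) ! Suc i) | i. Suc i < length (x # y # xs)} =
      insert (x, y) {((y # xs) ! i, (y # xs) ! Suc i) | i. Suc i < length (y # xs)}"
    (is "?L = insert _ ?R")
  proof (intro equalityI subsetI)
    fix e assume "e \<in> ?L"
    then obtain i where "e = ((x # y # xs) ! i, (x # y # xs) ! Suc i)" "Suc i < length (x # y # xs)"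
      by auto
    then show "e \<in> insert (x, y) ?R" by (cases i) auto
  next
    fix e assume "e \<in> insert (x, y) ?R"
    then consider "e = (x, y)" | i where "e = ((y # xs) ! i, (y # xs) ! Suc i)" "Suc i < length (y # xs)"
      by auto
    then show "e \<in> ?L"
    proof cases
      case 1
      then show ?thesis by (auto intro!: exI[of _ 0])
    next
      case (2 i)
      then show ?thesis by (auto intro!: exI[of _ "Suc i"])
    qed
  qed
  with 3 show ?case by simp
qed auto

lemma path_arcs_conv_nth:
  "parcs (path_graph P) =
    {(P ! i, P ! j) | i j. i < length P \<and> j < length P \<and> (i = Suc j \<or> j = Suc i)}"
  unfolding path_graph_def set_vwalk_arcs_conv_nth by fastforce

lemma path_arcs_nth_iff:
  assumes "distinct P" "i < length P" "j < length P"
  shows "(P ! i, P ! j) \<in> parcs (path_graph P) \<longleftrightarrow> i = Suc j \<or> j = Suc i"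
  using assms by (auto simp: path_arcs_conv_nth nth_eq_iff_index_eq)

lemma path_arcs_subset: "parcs (path_graph P) \<subseteq> set P \<times> set P"
  by (auto simp: path_arcs_conv_nth)

lemma sym_path_arcs: "sym (parcs (path_graph P))"
  by (auto simp: path_graph_def sym_def)

lemma path_arcs_no_loop: "distinct P \<Longrightarrow> (v, v) \<notin> parcs (path_graph P)"
  by (auto simp: path_arcs_conv_nth nth_eq_iff_index_eq)

lemma path_nbrs:
  assumes "distinct P" "i < length P"
  shows "parcs (path_graph P) `` {P ! i} =
    (!) P ` {j. j < length P \<and> (i = Suc j \<or> j = Suc i)}"
  using assms by (auto simp: path_arcs_conv_nth nth_eq_iff_index_eq)

lemma path_end_nbrs:
  assumes "distinct P" "2 \<le> length P"
  shows "parcs (path_graph P) `` {hd P} = {P ! 1}"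
    "parcs (path_graph P) `` {last P} = {last (butlast P)}"
proof -
  have P: "P \<noteq> []" "butlast P \<noteq> []" using assms by (auto simp: butlast_conv_take)
  have "{j. j < length P \<and> (0 = Suc j \<or> j = Suc 0)} = {1}" using assms by auto
  then show "parcs (path_graph P) `` {hd P} = {P ! 1}"
    using path_nbrs[OF assms(1), of 0] P by (simp add: hd_conv_nth)
  have "last (butlast P) = P ! (length P - 2)"
    using assms P by (auto simp: last_conv_nth nth_butlast numeral_2_eq_2)
  moreover have "{j. j < length P \<and> (length P - 1 = Suc j \<or> j = Suc (length P - 1))} =
      {length P - 2}"
    using assms by auto
  ultimately show "parcs (path_graph P) `` {last P} = {last (butlast P)}"
    using path_nbrs[OF assms(1), of "length P - 1"] P by (simp add: last_conv_nth)
qed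

lemma card_path_nbrs_inner:
  assumes "distinct P" "v \<in> set P - {hd P, last P}"
  shows "card (parcs (path_graph P) `` {v}) = 2"
proof -
  obtain i where i: "i < length P" "v = P ! i"
    using assms(2) by (auto simp: in_set_conv_nth)
  have "i \<noteq> 0" "i \<noteq> length P - 1"
    using assms(2) i hd_conv_nth[of P] last_conv_nth[of P] by force+
  then have "{j. j < length P \<and> (i = Suc j \<or> j = Suc i)} = {i - 1, Suc i}"
    using i by auto
  then have "parcs (path_graph P) `` {v} = {P ! (i - 1), P ! Suc i}"
    using path_nbrs[OF assms(1) i(1)] i(2) by simp
  moreover have "P ! (i - 1) \<noteq> P ! Suc i"
    using i(1) \<open>i \<noteq> 0\<close> \<open>i \<noteq> length P - 1\<close> assms(1) by (subst nth_eq_iff_index_eq) auto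
  ultimately show ?thesis by simp
qed

text \<open>Ends have degree 1 and diagonal entry x - 1, which is \<open>d + b\<close>; inner
  vertices have degree 2 and entry \<open>d\<close>. Deleting ends leaves a contiguous sublist, so
  each minor is again tridiagonal.\<close>

lemma sdet_path:
  fixes q :: real
  assumes "distinct P" "P = u # ys @ [w]"
  defines "L \<equiv> lap q (parcs (path_graph P))" and "b \<equiv> [: q\<^sup>2 :]" and "d \<equiv> [: - 1 - q\<^sup>2, 1 :]"
  shows "sdet (set P) L = continuant b ((d + b) # replicate (length ys) d @ [d + b])"
    "sdet (set P - {u}) L = continuant b (replicate (length ys) d @ [d + b])"
    "sdet (set P - {w}) L = continuant b ((d + b) # replicate (length ys) d)"
    "sdet (set P - {u, w}) L = continuant b (replicate (length ys) d)"
proof -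
  have tri: "tridiagonal L [:q:] P"
    unfolding tridiagonal_def L_def using assms(1)
    by (auto simp: lap_def path_arcs_nth_iff nth_eq_iff_index_eq)
  have tri1: "tridiagonal L [:q:] (ys @ [w])" and tri2: "tridiagonal L [:q:] (u # ys)"
    and tri3: "tridiagonal L [:q:] ys"
    using tri tridiagonal_ConsD tridiagonal_appendD1[of L "[:q:]" "u # ys" "[w]"] assms(2)
      tridiagonal_ConsD[of L "[:q:]" u ys] by auto
  have ends: "L u u = d + b" "L w w = d + b"
    using path_end_nbrs[OF assms(1)] assms(2) by (auto simp: L_def lap_def d_def b_def)
  have "L y y = d" if "y \<in> set ys" for y
  proof -
    have "y \<in> set P - {hd P, last P}" using that assms(1,2) by auto
    then have "card (parcs (path_graph P) `` {y}) = 2"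
      by (rule card_path_nbrs_inner[OF assms(1)])
    then show ?thesis by (simp add: L_def lap_def d_def)
  qed
  then have inner: "map (\<lambda>x. L x x) ys = replicate (length ys) d"
    by (simp add: map_replicate_const[symmetric] cong: map_cong)
  have b: "[:q:]\<^sup>2 = b" by (simp add: b_def power2_eq_square)
  have dist: "distinct (ys @ [w])" "distinct (u # ys)" "distinct ys" using assms by auto
  have sets: "set P - {u} = set (ys @ [w])" "set P - {w} = set (u # ys)" "set P - {u, w} = set ys"
    using assms(1,2) by auto
  show "sdet (set P) L = continuant b ((d + b) # replicate (length ys) d @ [d + b])"
    using sdet_tridiagonal[OF assms(1) tri] inner ends by (simp add: b assms(2))
  show "sdet (set P - {u}) L = continuant b (replicate (length ys) d @ [d + b])"
    using sdet_tridiagonal[OF dist(1) tri1] inner ends by (simp only: b sets) simp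
  show "sdet (set P - {w}) L = continuant b ((d + b) # replicate (length ys) d)"
    using sdet_tridiagonal[OF dist(2) tri2] inner ends by (simp only: b sets) simp
  show "sdet (set P - {u, w}) L = continuant b (replicate (length ys) d)"
    using sdet_tridiagonal[OF dist(3) tri3] inner by (simp only: b sets)
qed

lemma path_split_ends:
  assumes "2 \<le> length P"
  shows "P = hd P # tl (butlast P) @ [last P]"
  using assms by (cases P; cases "tl P" rule: rev_cases) auto

text \<open>Reversal symmetry of the path: both minors reduce to the same combination of continuants
  of constant lists.\<close>

lemma sdet_path_ends:
  assumes "distinct P" "2 \<le> length P"
  shows "sdet (set P - {hd P}) (lap q (parcs (path_graph P))) =
    sdet (set P - {last P}) (lap q (parcs (path_graph P)))"
  using sdet_path(2,3)[OF assms(1) path_split_ends[OF assms(2)], of q]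
  by (simp only: continuant_replicate_snoc continuant_Cons_replicate)

lemma F_aux_path:
  assumes "distinct P" "2 \<le> length P"
  shows "F_aux q (path_graph P) (hd P) =
    - [: 0, q\<^sup>2 :] * sdet (set P - {hd P, last P}) (lap q (parcs (path_graph P)))"
proof -
  note path = sdet_path[OF assms(1) path_split_ends[OF assms(2)], of q]
  let ?b = "[: q\<^sup>2 :]" and ?d = "[: - 1 - q\<^sup>2, 1 :]" and ?L = "lap q (parcs (path_graph P))"
  have "hd P \<in> set P" using assms(2) by (cases P) auto
  then have "F_aux q (path_graph P) (hd P) =
      sdet (set P) ?L - [: q\<^sup>2 - 1, 1 :] * sdet (set P - {hd P}) ?L"
    using F_aux_eq_sdet[of "path_graph P" "hd P" q] path_arcs_no_loop[OF assms(1)]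
    by (simp add: path_graph_def)
  also have "[: q\<^sup>2 - 1, 1 :] = ?d + 2 * ?b"
    by (simp add: numeral_poly)
  also have "sdet (set P) ?L - (?d + 2 * ?b) * sdet (set P - {hd P}) ?L =
      - ?b * (?d + 1 + ?b) * sdet (set P - {hd P, last P}) ?L"
    unfolding path by (rule continuant_path)
  also have "- ?b * (?d + 1 + ?b) = - [: 0, q\<^sup>2 :]"
    by (simp add: one_pCons)
  finally show ?thesis .
qed

section \<open>Splitting a tree along a path\<close>

lemma pcas_vwalk_arcs:
  "xs \<noteq> [] \<Longrightarrow> pcas (hd xs) (vwalk_arcs xs) (last xs) \<and> pawalk_verts (hd xs) (vwalk_arcs xs) = xs"
  by (induction xs rule: vwalk_arcs.induct) auto

lemma length_vwalk_arcs: "length (vwalk_arcs xs) = length xs - 1"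
  using vwalk_length_simp[of xs] unfolding vwalk_length_def .

text \<open>When the next vertex has already been visited, the walk is truncated at that earlier
  visit.\<close>

lemma rtrancl_imp_distinct_vwalk:
  assumes "(x, y) \<in> R\<^sup>*"
  shows "\<exists>Q. Q \<noteq> [] \<and> hd Q = x \<and> last Q = y \<and> distinct Q \<and> set (vwalk_arcs Q) \<subseteq> R"
  using assms
proof (induction rule: rtrancl_induct)
  case base
  show ?case by (rule exI[of _ "[x]"]) simp
next
  case (step y z)
  then obtain Q where Q: "Q \<noteq> []" "hd Q = x" "last Q = y" "distinct Q" "set (vwalk_arcs Q) \<subseteq> R"
    by blast
  show ?case
  proof (cases "z \<in> set Q")
    case True
    then obtain as bs where "Q = as @ z # bs" by (auto simp: in_set_conv_decomp)
    with Q have "hd (as @ [z]) = x" "distinct (as @ [z])" "set (vwalk_arcs (as @ [z])) \<subseteq> R"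
      using set_vwalk_arcs_append1[of "as @ [z]" bs] by (auto simp: hd_append)
    then show ?thesis by (intro exI[of _ "as @ [z]"]) auto
  next
    case False
    then show ?thesis
      using Q step(2) by (intro exI[of _ "Q @ [z]"]) (auto simp: vwalk_arcs_append)
  qed
qed

text \<open>Used contrapositively: a nontrivial walk in \<open>R\<close> avoids every vertex that is
  isolated in \<open>R\<close>.\<close>

lemma vwalk_arcs_incident:
  assumes "v \<in> set Q" "2 \<le> length Q" "set (vwalk_arcs Q) \<subseteq> R" "sym R"
  shows "R `` {v} \<noteq> {}"
proof -
  obtain i where i: "i < length Q" "v = Q ! i" using assms(1) by (auto simp: in_set_conv_nth)
  have "\<exists>z. (v, z) \<in> R \<or> (z, v) \<in> R"
  proof (cases "Suc i < length Q")
    case True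
    then have "(Q ! i, Q ! Suc i) \<in> R" using assms(3) by (auto simp: set_vwalk_arcs_conv_nth)
    then show ?thesis using i by auto
  next
    case False
    then obtain j where j: "i = Suc j" using assms(2) by (cases i) auto
    then have "(Q ! j, Q ! Suc j) \<in> R"
      using assms(3) i(1) by (auto simp: set_vwalk_arcs_conv_nth)
    then show ?thesis using i j by auto
  qed
  then show ?thesis using assms(4) by (auto dest: symD)
qed

lemma component_conv_rtrancl:
  assumes "is_component H G" "v \<in> pverts H" "sym (parcs G)" "parcs G \<subseteq> pverts G \<times> pverts G"
  shows "pverts H = {x. (v, x) \<in> (parcs G)\<^sup>*}" "parcs H = parcs G \<inter> pverts H \<times> pverts H"
proof -
  interpret pair_sym_digraph G
  proof unfold_locales
    show "fst e \<in> pverts G" "snd e \<in> pverts G" if "e \<in> parcs G" for e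
      using that assms(4) by (cases e; auto)+
    show "symmetric (with_proj G)"
      using assms(3) by (simp add: symmetric_def)
  qed
  have scc: "with_proj H \<in> sccs" using assms(1) by (simp add: is_component_def)
  then have ind: "induced_subgraph (with_proj H) (with_proj G)" by (rule in_sccs_imp_induced)
  then have "parcs H = {e \<in> parcs G. fst e \<in> pverts H \<and> snd e \<in> pverts H}"
    unfolding induced_subgraph_def with_proj_simps by blast
  then show "parcs H = parcs G \<inter> pverts H \<times> pverts H"
    by (simp add: set_eq_iff mem_Times_iff)
  have sub: "pverts H \<subseteq> pverts G" using ind by (auto simp: induced_subgraph_def subgraph_def)
  have S: "pverts H \<in> sccs_verts"
    using scc imageI[OF scc, of verts] by (intro in_sccs_vertsI_sccs) simp
  have reach: "v \<rightarrow>\<^sup>*\<^bsub>with_proj G\<^esub> x \<longleftrightarrow> (v, x) \<in> (parcs G)\<^sup>*" for x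
  proof
    show "v \<rightarrow>\<^sup>*\<^bsub>with_proj G\<^esub> x \<Longrightarrow> (v, x) \<in> (parcs G)\<^sup>*"
      using reachable_rtranclI[of "with_proj G"] by simp
    assume "(v, x) \<in> (parcs G)\<^sup>*"
    then show "v \<rightarrow>\<^sup>*\<^bsub>with_proj G\<^esub> x"
    proof induction
      case base
      then show ?case using assms(2) sub by auto
    next
      case (step y z)
      then show ?case by (auto intro: reachable_adj_trans)
    qed
  qed
  have "x \<in> pverts H \<longleftrightarrow> v \<rightarrow>\<^sup>*\<^bsub>with_proj G\<^esub> x" for x
    using S assms(2) symmetric_reachable[OF sym_arcs, of v x] unfolding sccs_verts_def by blast
  then show "pverts H = {x. (v, x) \<in> (parcs G)\<^sup>*}" using reach by auto
qed

lemma hd_neq_last: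
  assumes "distinct P" "2 \<le> length P"
  shows "hd P \<noteq> last P"
  using assms by (cases P) auto

text \<open>The path already supplies two neighbours of an inner vertex, and its degree is
  2.\<close>

lemma path_inner_isolated:
  assumes "distinct P" "parcs (path_graph P) \<subseteq> E"
    and "v \<in> set P - {hd P, last P}" "card (E `` {v}) = 2"
  shows "(E - parcs (path_graph P)) `` {v} = {}"
proof -
  have "finite (E `` {v})" using assms(4) by (intro card_ge_0_finite) simp
  moreover have "parcs (path_graph P) `` {v} \<subseteq> E `` {v}" using assms(2) by auto
  ultimately have "parcs (path_graph P) `` {v} = E `` {v}"
    using card_path_nbrs_inner[OF assms(1,3)] assms(4) by (intro card_subset_eq) auto
  then show ?thesis by auto
qed

text \<open>Acyclicity of the tree is reduced to one consequence: the ends of \<open>P\<close> are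
  not joined by a walk off \<open>P\<close>.\<close>

locale tree_path =
  fixes V :: "'a set" and E :: "'a rel" and P :: "'a list"
  assumes fin: "finite V" and E_sub: "E \<subseteq> V \<times> V" and sym_E: "sym E" and noloop: "(v, v) \<notin> E"
    and dist: "distinct P" and len: "2 \<le> length P" and P_sub: "set P \<subseteq> V"
    and P_arcs: "parcs (path_graph P) \<subseteq> E"
    and inner: "v \<in> set P - {hd P, last P} \<Longrightarrow> card (E `` {v}) = 2"
    and conn: "v \<in> V \<Longrightarrow> (hd P, v) \<in> E\<^sup>*"
    and acyclic: "(hd P, last P) \<notin> (E - parcs (path_graph P))\<^sup>*"
begin

abbreviation "u \<equiv> hd P"
abbreviation "w \<equiv> last P"
abbreviation "EP \<equiv> parcs (path_graph P)"

section \<open>The two branches left after removing the edges of the path\<close>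

definition "R = E - EP"
definition "V1 = {x. (u, x) \<in> R\<^sup>*}"
definition "V2 = {x. (w, x) \<in> R\<^sup>*}"
definition "E1 = R \<inter> V1 \<times> V1"
definition "E2 = R \<inter> V2 \<times> V2"

lemma P_ends: "u \<in> set P" "w \<in> set P" "u \<noteq> w"
proof -
  have "P \<noteq> []" using len by auto
  then show "u \<in> set P" "w \<in> set P" by auto
  show "u \<noteq> w" by (rule hd_neq_last[OF dist len])
qed

lemma sym_R: "sym R"
  using sym_E sym_path_arcs[of P] by (auto simp: R_def sym_def)

lemma R_sub: "R \<subseteq> V \<times> V"
  using E_sub by (auto simp: R_def)

lemma R_inner: "R `` {v} = {}" if "v \<in> set P - {u, w}"
  unfolding R_def by (rule path_inner_isolated[OF dist P_arcs that inner[OF that]])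

lemma rtrancl_R_inner: "x = v" if "(v, x) \<in> R\<^sup>*" "v \<in> set P - {u, w}"
  using that(1) R_inner[OF that(2)] by (auto elim: converse_rtranclE)

lemma rtrancl_R_sym: "(x, y) \<in> R\<^sup>* \<Longrightarrow> (y, x) \<in> R\<^sup>*"
  using sym_rtrancl[OF sym_R] by (rule symD)

lemma V_sub: "V1 \<subseteq> V" "V2 \<subseteq> V"
proof -
  have "x \<in> V" if "(y, x) \<in> R\<^sup>*" "y \<in> V" for x y
    using that by (induction rule: rtrancl_induct) (use R_sub in auto)
  then show "V1 \<subseteq> V" "V2 \<subseteq> V" using P_ends P_sub by (auto simp: V1_def V2_def)
qed

lemma V12_disjoint: "V1 \<inter> V2 = {}"
  using acyclic rtrancl_R_sym unfolding V1_def V2_def R_def[symmetric]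
  by (auto dest: rtrancl_trans)

lemma ends_in: "u \<in> V1" "w \<in> V2"
  by (auto simp: V1_def V2_def)

lemma V1_P: "V1 \<inter> set P = {u}"
proof -
  have "x = u" if "x \<in> V1" "x \<in> set P" for x
  proof -
    have "(x, u) \<in> R\<^sup>*" using that(1) rtrancl_R_sym by (simp add: V1_def)
    moreover have "x \<noteq> w" using that(1) V12_disjoint ends_in by auto
    ultimately show ?thesis using rtrancl_R_inner[of x u] that(2) by auto
  qed
  then show ?thesis using ends_in P_ends by blast
qed

lemma V2_P: "V2 \<inter> set P = {w}"
proof -
  have "x = w" if "x \<in> V2" "x \<in> set P" for x
  proof -
    have "(x, w) \<in> R\<^sup>*" using that(1) rtrancl_R_sym by (simp add: V2_def)
    moreover have "x \<noteq> u" using that(1) V12_disjoint ends_in by auto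
    ultimately show ?thesis using rtrancl_R_inner[of x w] that(2) by auto
  qed
  then show ?thesis using ends_in P_ends by blast
qed

text \<open>Induction along a walk from \<open>u\<close>: an arc off the path cannot start at an
  inner vertex, so it starts in one of the branches and stays there.\<close>

lemma V_eq: "V = V1 \<union> V2 \<union> set P"
proof -
  have "v \<in> V1 \<union> V2 \<union> set P" if "(u, v) \<in> E\<^sup>*" for v
    using that
  proof (induction rule: rtrancl_induct)
    case base
    then show ?case using ends_in by simp
  next
    case (step y z)
    show ?case
    proof (cases "(y, z) \<in> EP")
      case True
      then show ?thesis using path_arcs_subset[of P] by auto
    next
      case False
      then have yz: "(y, z) \<in> R" using step(2) by (simp add: R_def)
      then have "y \<notin> set P - {u, w}" using R_inner[of y] by auto
      then have "y \<in> V1 \<or> y \<in> V2" using step(3) ends_in by auto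
      then show ?thesis using yz by (auto simp: V1_def V2_def intro: rtrancl_into_rtrancl)
    qed
  qed
  then show ?thesis using conn V_sub P_sub by auto
qed

lemma R_eq: "R = E1 \<union> E2"
proof -
  have "(x, y) \<in> E1 \<union> E2" if xy: "(x, y) \<in> R" for x y
  proof -
    have "x \<notin> set P - {u, w}" using R_inner[of x] xy by auto
    then have "x \<in> V1 \<or> x \<in> V2" using xy R_sub ends_in by (auto simp: V_eq)
    then show ?thesis
      using xy by (auto simp: E1_def E2_def V1_def V2_def intro: rtrancl_into_rtrancl)
  qed
  then show ?thesis by (auto simp: E1_def E2_def)
qed

lemma E_eq: "E = E2 \<union> (E1 \<union> EP)"
  using R_eq P_arcs by (auto simp: R_def)

lemma E_iff: "e \<in> E \<longleftrightarrow> e \<in> E2 \<or> e \<in> E1 \<or> e \<in> EP"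
  using E_eq by blast

lemma E12_sub: "E1 \<subseteq> V1 \<times> V1" "E2 \<subseteq> V2 \<times> V2"
  by (auto simp: E1_def E2_def)

lemma E12_no_loop: "(v, v) \<notin> E1" "(v, v) \<notin> E2"
  using noloop by (auto simp: E1_def E2_def R_def)

lemma fin12: "finite V1" "finite V2"
  using V_sub fin finite_subset by auto

section \<open>The shift as a relabelling of the second branch\<close>

definition shift where "shift x = (if x = w then u else x)"

text \<open>The value \<open>u\<close> is free because it belongs to the disjoint branch
  \<open>V1\<close>.\<close>

lemma inj_shift: "inj_on shift V2"
  using V12_disjoint ends_in by (auto simp: inj_on_def shift_def)

lemma shift_V2: "shift ` V2 = insert u (V2 - {w})"
  using ends_in by (auto simp: shift_def)

definition E2' where "E2' = map_prod shift shift ` E2"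

text \<open>The shift moves precisely the arcs of the second branch at \<open>w\<close>; replacing
  \<open>w\<close> by \<open>u\<close> in them is the relabelling \<open>shift\<close>. The first
  branch and the path stay fixed.\<close>

lemma parcs_gts:
  assumes "parcs T = E"
  shows "parcs (gts T P) = E2' \<union> (E1 \<union> EP)"
proof -
  define Z where "Z = E2 `` {w}"
  have w1: "w \<notin> V1" using ends_in V12_disjoint by auto
  \<comment> \<open>The excluded vertex is the only path neighbour of \<open>w\<close>. It lies on
    \<open>P\<close> and differs from \<open>w\<close>, hence is outside \<open>V2\<close>.\<close>
  have "{z. (w, z) \<in> E \<and> z \<noteq> last (butlast P)} = Z"
  proof -
    have w': "EP `` {w} = {last (butlast P)}" by (rule path_end_nbrs[OF dist len])
    then have "(w, last (butlast P)) \<in> EP" by auto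
    then have "last (butlast P) \<in> set P" "last (butlast P) \<noteq> w"
      using path_arcs_subset[of P] path_arcs_no_loop[OF dist] by auto
    then have "last (butlast P) \<notin> V2" using V2_P by auto
    then show ?thesis using w' w1 E12_sub by (auto simp: Z_def E_iff)
  qed
  then have "parcs (gts T P) = (E - ({w} \<times> Z \<union> Z \<times> {w})) \<union> ({u} \<times> Z \<union> Z \<times> {u})"
    using assms by (simp add: gts_def Let_def)
  \<comment> \<open>No deleted arc belongs to \<open>E1\<close> or \<open>EP\<close>: it has an end
    in \<open>V2 - {w}\<close>, which meets neither \<open>V1\<close> nor \<open>P\<close>.\<close>
  also have "E - ({w} \<times> Z \<union> Z \<times> {w}) = (E2 - ({w} \<times> Z \<union> Z \<times> {w})) \<union> (E1 \<union> EP)"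
  proof -
    have "Z \<subseteq> V2 - {w}" using E12_sub E12_no_loop by (auto simp: Z_def)
    then have "e \<notin> E1 \<union> EP" if "e \<in> {w} \<times> Z \<union> Z \<times> {w}" for e
      using that E12_sub w1 path_arcs_subset[of P] V2_P by auto
    then show ?thesis using E_iff by blast
  qed
  also have "(E2 - ({w} \<times> Z \<union> Z \<times> {w})) \<union> (E1 \<union> EP) \<union> ({u} \<times> Z \<union> Z \<times> {u}) =
      ((E2 - ({w} \<times> Z \<union> Z \<times> {w})) \<union> ({u} \<times> Z \<union> Z \<times> {u})) \<union> (E1 \<union> EP)"
    by blast
  also have "(E2 - ({w} \<times> Z \<union> Z \<times> {w})) \<union> ({u} \<times> Z \<union> Z \<times> {u}) = E2'"
  proof -
    have "sym E2" using sym_R by (auto simp: E2_def sym_def)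
    then have Z: "(w, z) \<in> E2 \<longleftrightarrow> z \<in> Z" "(z, w) \<in> E2 \<longleftrightarrow> z \<in> Z" for z
      by (auto simp: Z_def dest: symD)
    have wZ: "w \<notin> Z" using E12_no_loop Z by blast
    show ?thesis
    proof (intro equalityI subsetI)
      fix e assume "e \<in> (E2 - ({w} \<times> Z \<union> Z \<times> {w})) \<union> ({u} \<times> Z \<union> Z \<times> {u})"
      then obtain x y where e: "e = (x, y)" and
        "((x, y) \<in> E2 \<and> x \<noteq> w \<and> y \<noteq> w) \<or> (x = u \<and> y \<in> Z) \<or> (x \<in> Z \<and> y = u)"
        using Z by (cases e) auto
      then consider "(x, y) \<in> E2" "x \<noteq> w" "y \<noteq> w" | "x = u" "y \<in> Z" | "x \<in> Z" "y = u"
        by blast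
      then obtain a b where ab: "(a, b) \<in> E2" "x = shift a" "y = shift b"
      proof cases
        case 1
        then show ?thesis using that[of x y] by (simp add: shift_def)
      next
        case 2
        then have "y \<noteq> w" using wZ by blast
        with 2 show ?thesis using that[of w y] Z(1) by (simp add: shift_def)
      next
        case 3
        then have "x \<noteq> w" using wZ by blast
        with 3 show ?thesis using that[of x w] Z(2) by (simp add: shift_def)
      qed
      then show "e \<in> E2'" unfolding E2'_def e by force
    next
      fix e assume "e \<in> E2'"
      then obtain x y where xy: "(x, y) \<in> E2" "e = (shift x, shift y)" by (auto simp: E2'_def)
      then show "e \<in> (E2 - ({w} \<times> Z \<union> Z \<times> {w})) \<union> ({u} \<times> Z \<union> Z \<times> {u})"
        using Z wZ by (auto simp: shift_def)
    qed
  qed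
  finally show ?thesis .
qed

lemma E2'_sub: "E2' \<subseteq> shift ` V2 \<times> shift ` V2"
  using E12_sub by (auto simp: E2'_def)

lemma E2'_no_loop: "(v, v) \<notin> E2'"
proof
  assume "(v, v) \<in> E2'"
  then obtain x y where "(x, y) \<in> E2" "shift x = shift y" by (auto simp: E2'_def)
  with inj_shift E12_sub E12_no_loop show False by (auto dest: inj_onD)
qed

lemma gts_no_loop:
  assumes "parcs T = E"
  shows "(v, v) \<notin> parcs (gts T P)"
  using parcs_gts[OF assms] E2'_no_loop E12_no_loop path_arcs_no_loop[OF dist] by auto

text \<open>Write \<open>B\<close> for the first branch with the path. Gluing the second branch to
  \<open>B\<close> at \<open>w\<close> or at \<open>u\<close> gives expressions that differ only in
  the minor of \<open>B\<close>, at \<open>w\<close> or at \<open>u\<close>. Splitting these minors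
  at \<open>u\<close> leaves one uncancelled term.\<close>

lemma sdet_gts_diff:
  fixes q :: real
  assumes "parcs T = E"
  defines "c \<equiv> [: q\<^sup>2 - 1, 1 :]"
  shows "sdet V (lap q E) - sdet V (lap q (parcs (gts T P))) =
    (sdet V1 (lap q E1) - c * sdet (V1 - {u}) (lap q E1)) *
    (sdet V2 (lap q E2) - c * sdet (V2 - {w}) (lap q E2)) *
    sdet (set P - {u, w}) (lap q EP)"
proof -
  let ?L1 = "lap q E1" and ?L2 = "lap q E2" and ?LP = "lap q EP" and ?L = "lap q (E1 \<union> EP)"
  let ?B = "V1 \<union> set P"
  define F1 where "F1 = sdet V1 ?L1 - c * sdet (V1 - {u}) ?L1"
  define F2 where "F2 = sdet V2 ?L2 - c * sdet (V2 - {w}) ?L2"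
  have B_sub: "E1 \<union> EP \<subseteq> ?B \<times> ?B" using E12_sub path_arcs_subset[of P] by blast
  have B_fin: "finite ?B" using fin12 by simp
  have "V2 \<inter> ?B = {w}" using V12_disjoint V2_P by auto
  then have "sdet (V2 \<union> ?B) (lap q (E2 \<union> (E1 \<union> EP))) =
      F2 * sdet (?B - {w}) ?L + sdet (V2 - {w}) ?L2 * sdet ?B ?L"
    unfolding F2_def c_def
    by (rule sdet_lap_glue[OF fin12(2) B_fin _ E12_sub(2) B_sub E12_no_loop(2)]) (use P_ends in auto)
  moreover have "V = V2 \<union> ?B" using V_eq by auto
  ultimately have T1: "sdet V (lap q E) =
      F2 * sdet (?B - {w}) ?L + sdet (V2 - {w}) ?L2 * sdet ?B ?L"
    unfolding E_eq[symmetric] by simp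
  \<comment> \<open>The minor of \<open>B\<close> at \<open>w\<close> is glued at \<open>u\<close>
    from the first branch and the path minor, with \<open>S = set P - {w}\<close>.\<close>
  have "sdet (V1 \<union> (set P - {w})) ?L =
      F1 * sdet (set P - {w} - {u}) ?LP + sdet (V1 - {u}) ?L1 * sdet (set P - {w}) ?LP"
    unfolding F1_def c_def
    by (rule sdet_lap_glue[OF fin12(1) finite_set V1_P E12_sub(1) path_arcs_subset E12_no_loop(1)])
      (use P_ends in auto)
  moreover have "V1 \<union> (set P - {w}) = ?B - {w}" "set P - {w} - {u} = set P - {u, w}"
    using V12_disjoint ends_in by auto
  ultimately have Bw: "sdet (?B - {w}) ?L =
      F1 * sdet (set P - {u, w}) ?LP + sdet (V1 - {u}) ?L1 * sdet (set P - {w}) ?LP"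
    by simp
  have Bu: "sdet (?B - {u}) ?L = sdet (V1 - {u}) ?L1 * sdet (set P - {u}) ?LP"
    by (rule sdet_lap_cut[OF fin12(1) finite_set V1_P E12_sub(1) path_arcs_subset])
  \<comment> \<open>The vertex \<open>w\<close> remains in \<open>B\<close> as an end of the path,
    so the vertex set is unchanged although the relabelled branch now meets \<open>B\<close> at
    \<open>u\<close>.\<close>
  have V2': "shift ` V2 \<inter> ?B = {u}" "V = shift ` V2 \<union> ?B"
    using V12_disjoint V2_P P_ends ends_in unfolding shift_V2 V_eq by auto
  have "sdet V (lap q (E2' \<union> (E1 \<union> EP))) =
      (sdet (shift ` V2) (lap q E2') - c * sdet (shift ` V2 - {u}) (lap q E2')) * sdet (?B - {u}) ?L
      + sdet (shift ` V2 - {u}) (lap q E2') * sdet ?B ?L"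
    unfolding V2'(2) c_def
    by (rule sdet_lap_glue[OF _ B_fin V2'(1) E2'_sub B_sub E2'_no_loop])
      (use P_ends fin12 in auto)
  moreover have "sdet (shift ` V2) (lap q E2') = sdet V2 ?L2"
    unfolding E2'_def by (rule sdet_lap_image[OF fin12(2) inj_shift E12_sub(2)]) simp
  moreover have "shift ` V2 - {u} = shift ` (V2 - {w})"
    using ends_in V12_disjoint by (auto simp: shift_def)
  moreover have "sdet (shift ` (V2 - {w})) (lap q E2') = sdet (V2 - {w}) ?L2"
    unfolding E2'_def by (rule sdet_lap_image[OF fin12(2) inj_shift E12_sub(2)]) auto
  ultimately have T2: "sdet V (lap q (parcs (gts T P))) =
      F2 * sdet (?B - {u}) ?L + sdet (V2 - {w}) ?L2 * sdet ?B ?L"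
    unfolding parcs_gts[OF assms(1)] F2_def by simp
  show ?thesis
    unfolding T1 T2 Bw Bu F1_def[symmetric] F2_def[symmetric] sdet_path_ends[OF dist len]
    by (simp add: algebra_simps)
qed

end

text \<open>A walk off \<open>P\<close> joining its ends would close up with \<open>P\<close> to a
  cycle with at least three arcs.\<close>

lemma tree_path_of_tree:
  assumes tree: "is_tree T" and path: "gts_path T P"
  shows "tree_path (pverts T) (parcs T) P"
proof -
  interpret pair_graph T using tree by (simp add: is_tree_def)
  have sub: "parcs T \<subseteq> pverts T \<times> pverts T" using wellformed' by auto
  have sym: "sym (parcs T)" using sym_arcs by (simp add: symmetric_def)
  have len: "2 \<le> length P" and dist: "distinct P" and P_sub: "set P \<subseteq> pverts T"
    and walk: "set (vwalk_arcs P) \<subseteq> parcs T" and ne: "P \<noteq> []"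
    using path by (auto simp: gts_path_def vpath_def vwalk_def)
  have arcs: "parcs (path_graph P) \<subseteq> parcs T"
    using walk sym by (auto simp: path_graph_def dest: symD)
  have inner: "card (parcs T `` {v}) = 2" if "v \<in> set P - {hd P, last P}" for v
    using path that by (simp add: gts_path_def degree_of_conv_card)
  have conn: "(hd P, v) \<in> (parcs T)\<^sup>*" if "v \<in> pverts T" for v
  proof -
    have "hd P \<in> pverts T" using P_sub ne by auto
    \<comment> \<open>Connectedness is strong connectedness of the symmetric closure, which has the
      same reachability here because the arcs are symmetric.\<close>
    have "hd P \<rightarrow>\<^sup>*\<^bsub>with_proj (mk_symmetric (with_proj T))\<^esub> v"
      using tree that \<open>hd P \<in> pverts T\<close>
      unfolding is_tree_def connected_def strongly_connected_def by simp
    then have "hd P \<rightarrow>\<^sup>*\<^bsub>with_proj T\<^esub> v"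
      using reachable_mk_symmetric_eq[OF sym_arcs] by simp
    then show ?thesis using reachable_rtranclI[of "with_proj T"] by simp
  qed
  have noloop: "(v, v) \<notin> parcs T" for v using pair_no_loops[of "(v, v)"] by auto
  define R where "R = parcs T - parcs (path_graph P)"
  have symR: "sym R" using sym sym_path_arcs[of P] by (auto simp: R_def sym_def)
  have innerR: "R `` {v} = {}" if "v \<in> set P - {hd P, last P}" for v
    unfolding R_def by (rule path_inner_isolated[OF dist arcs that inner[OF that]])
  have ends: "hd P \<noteq> last P" by (rule hd_neq_last[OF dist len])
  have "(last P, hd P) \<notin> R\<^sup>*"
  proof
    assume "(last P, hd P) \<in> R\<^sup>*"
    then obtain Q where Q: "Q \<noteq> []" "hd Q = last P" "last Q = hd P" "distinct Q"
      "set (vwalk_arcs Q) \<subseteq> R"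
      using rtrancl_imp_distinct_vwalk by metis
    have lenQ: "2 \<le> length Q"
      using Q ends by (cases Q; cases "tl Q") auto
    obtain Q' where Q': "Q = last P # Q'" "Q' \<noteq> []"
      using Q lenQ by (cases Q; cases "tl Q") auto
    \<comment> \<open>\<open>C\<close> follows \<open>P\<close> from \<open>u\<close> to
      \<open>w\<close> and then \<open>Q\<close> back to \<open>u\<close>; the first vertex of
      \<open>Q\<close> is dropped since \<open>P\<close> ends there.\<close>
    define C where "C = P @ Q'"
    have C: "C \<noteq> []" "hd C = hd P" "last C = hd P"
      using Q Q' ne by (auto simp: C_def)
    have arcsC: "vwalk_arcs C = vwalk_arcs P @ vwalk_arcs Q"
      using Q' ne by (simp add: C_def vwalk_arcs_append)
    \<comment> \<open>Inner vertices of \<open>P\<close> are isolated in \<open>R\<close>, so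
      \<open>Q\<close> meets \<open>P\<close> only in the ends. Without its head, \<open>P\<close>
      cannot meet \<open>Q'\<close>, from which \<open>w\<close> has been removed.\<close>
    have "set Q \<inter> (set P - {hd P, last P}) = {}"
      using vwalk_arcs_incident[OF _ lenQ Q(5) symR] innerR by blast
    moreover have "hd P \<notin> set (tl P)" using dist ne by (cases P) auto
    ultimately have "set (tl P) \<inter> set Q' = {}"
      using Q(4) Q' by (auto dest: list.set_sel(2)[OF ne])
    then have "distinct (tl C)"
      using dist Q(4) Q' ne by (auto simp: C_def distinct_tl)
    moreover have "awalk (hd P) (vwalk_arcs C) (hd P)"
      unfolding awalk_def using pcas_vwalk_arcs[OF C(1)] C(2,3) P_sub ne walk Q(5)
      by (auto simp: arcsC R_def)
    moreover have "pawalk_verts (hd P) (vwalk_arcs C) = C"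
      using pcas_vwalk_arcs[OF C(1)] C(2) by simp
    \<comment> \<open>With only two arcs, both walks would be single arcs, and \<open>Q\<close>
      would be the reverse of the arc of \<open>P\<close>, which \<open>R\<close> excludes.\<close>
    moreover have long: "3 \<le> length (vwalk_arcs C)"
    proof (rule ccontr)
      assume "\<not> 3 \<le> length (vwalk_arcs C)"
      then have "length P = 2" "length Q = 2"
        using len lenQ by (auto simp: arcsC length_vwalk_arcs)
      then obtain a b c d where PQ: "P = [a, b]" "Q = [c, d]"
        by (auto simp: length_Suc_conv numeral_2_eq_2)
      then have "c = b" "d = a" using Q(2,3) by simp_all
      with PQ Q(5) have "(b, a) \<in> R" "(b, a) \<in> parcs (path_graph P)"
        by (auto simp: path_graph_def)
      then show False by (simp add: R_def)
    qed
    ultimately have "cycle (vwalk_arcs C)"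
      unfolding cycle_def by (intro exI[of _ "hd P"]) auto
    then show False using tree long by (auto simp: is_tree_def)
  qed
  then have "(hd P, last P) \<notin> R\<^sup>*"
    using symD[OF sym_rtrancl[OF symR]] by blast
  then show ?thesis
    using pair_finite_verts sub sym dist len P_sub arcs inner conn noloop
    by unfold_locales (auto simp: R_def)
qed

section \<open>Assembly of the product formula in the fraction field\<close>

theorem theorem3p4:
  fixes T1 T2 H1 H2 :: "'a::linorder pair_pre_digraph"
    and P :: "'a list" and u w :: 'a and n :: nat and q :: real
  assumes "T1 \<in> trees_on n" and "T2 \<in> trees_on n"
    and "gts_covers n T1 T2"
    and "gts_path T1 P" and "hd P = u" and "last P = w"
    and "\<not> is_leaf T1 u" and "\<not> is_leaf T1 w"
    and "graph_iso (gts T1 P) T2"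
    and "is_component H1 (delete_edges T1 (parcs (path_graph P)))" and "u \<in> pverts H1"
    and "is_component H2 (delete_edges T1 (parcs (path_graph P)))" and "w \<in> pverts H2"
    and "q \<noteq> 0"
  shows "to_fract (f_lap q T1) - to_fract (f_lap q T2) =
    - (1 / to_fract [: 0, q\<^sup>2 :])
      * to_fract (F_aux q (path_graph P) u)
      * to_fract (F_aux q H1 u)
      * to_fract (F_aux q H2 w)"
proof -
  interpret t: tree_path "pverts T1" "parcs T1" P
    using assms(1,4) by (intro tree_path_of_tree) (auto simp: trees_on_def)
  have R: "parcs (delete_edges T1 (parcs (path_graph P))) = t.R"
    "pverts (delete_edges T1 (parcs (path_graph P))) = pverts T1"
    by (auto simp: delete_edges_def t.R_def)
  have H1: "pverts H1 = t.V1" "parcs H1 = t.E1"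
    using component_conv_rtrancl[OF assms(10,11)] t.sym_R t.R_sub assms(5)
    by (simp_all add: R t.V1_def t.E1_def)
  have H2: "pverts H2 = t.V2" "parcs H2 = t.E2"
    using component_conv_rtrancl[OF assms(12,13)] t.sym_R t.R_sub assms(6)
    by (simp_all add: R t.V2_def t.E2_def)
  have F1: "F_aux q H1 u = sdet t.V1 (lap q t.E1)
      - [: q\<^sup>2 - 1, 1 :] * sdet (t.V1 - {u}) (lap q t.E1)"
    using F_aux_eq_sdet[of H1 u q] assms(11) t.fin12 t.E12_no_loop by (simp add: H1)
  have F2: "F_aux q H2 w = sdet t.V2 (lap q t.E2)
      - [: q\<^sup>2 - 1, 1 :] * sdet (t.V2 - {w}) (lap q t.E2)"
    using F_aux_eq_sdet[of H2 w q] assms(13) t.fin12 t.E12_no_loop by (simp add: H2)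
  let ?p = "sdet (set P - {u, w}) (lap q (parcs (path_graph P)))"
  have verts: "pverts (gts T1 P) = pverts T1" by (simp add: gts_def Let_def)
  have "f_lap q T2 = f_lap q (gts T1 P)"
    using graph_iso_f_lap_eq[OF assms(9)] t.fin t.gts_no_loop[OF refl] verts by simp
  also have "\<dots> = sdet (pverts T1) (lap q (parcs (gts T1 P)))"
    using f_lap_eq_sdet[of "gts T1 P" q] t.fin t.gts_no_loop[OF refl] verts by simp
  finally have diff: "f_lap q T1 - f_lap q T2 = F_aux q H1 u * F_aux q H2 w * ?p"
    using t.sdet_gts_diff[OF refl, of q] t.fin t.noloop assms(5,6)
    by (simp add: f_lap_eq_sdet F1 F2)
  have FP: "F_aux q (path_graph P) u = - [: 0, q\<^sup>2 :] * ?p"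
    using F_aux_path[OF t.dist t.len, of q] assms(5,6) by simp
  have "to_fract [: 0, q\<^sup>2 :] \<noteq> 0" using assms(14) by simp
  \<comment> \<open>\<open>FP\<close> is solved for \<open>?p\<close>; the divisor q^2 x is nonzero
    because \<open>q\<close> is.\<close>
  then have "to_fract ?p = - (1 / to_fract [: 0, q\<^sup>2 :]) * to_fract (F_aux q (path_graph P) u)"
    unfolding FP by (simp only: to_fract_mult to_fract_uminus) (simp add: field_simps)
  moreover have "to_fract (f_lap q T1) - to_fract (f_lap q T2) =
      to_fract (F_aux q H1 u) * to_fract (F_aux q H2 w) * to_fract ?p"
    by (simp only: diff to_fract_diff[symmetric] to_fract_mult[symmetric])
  ultimately show ?thesis by (simp only: ac_simps)
qed

end
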